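(* Let $G$ be a compact Lie group. The deformed Yang--Mills action $$S_{\mathrm{YM}}^{(q)} = -\frac14\int_{\mathcal M_{\mathrm{eff}}} d^{d_{\mathrm{eff}}}x\,\sqrt{|\det g_{\mathrm{eff}}|}\;\operatorname{tr}\left(F_{ab}^{(q)}F_{(q)}^{ab}\right),\qquad F_{(q)}^{ab} = g_{\mathrm{eff}}^{ac}\,g_{\mathrm{eff}}^{bd}\,F_{cd}^{(q)},$$ is invariant under the gauge transformations $$A_a \longrightarrow U A_a U^{-1} + U(\partial_a U^{-1}),\qquad F_{ab}^{(q)} \longrightarrow U F_{ab}^{(q)} U^{-1},$$ where $U(x)\in G$ is an arbitrary local gauge transformation.
   Context: Let $g^{\mu\nu}=\operatorname{diag}(g^{00},g^{11},g^{22},g^{33})$ be a diagonal tensor, some of whose diagonal components may vanish. The effective non-degenerate sector $\mathcal M_{\mathrm{eff}}\subseteq\mathcal M$ of spacetime $\mathcal M$ is the submanifold spanned only by the coordinates with $g^{\mu\mu}\neq 0$; $d_{\mathrm{eff}}$ is the number of non-vanishing diagonal components; $g_{\mathrm{eff}}^{ab}$ is the restriction of $g^{\mu\nu}$ to $\mathcal M_{\mathrm{eff}}$ (a non-degenerate diagonal metric), with indices $a,b=0,\dots,d_{\mathrm{eff}}-1$ running over these coordinates only. The metric $g_{\mathrm{eff}}$ is a fixed background: it does not change under gauge transformations. The gauge field $A_a(x)$ takes values in the Lie algebra of $G$, acting as matrices in a representation, and $U(x)$ acts in the same representation. With $h_a(x)=1/\sqrt{|g_{\mathrm{eff}}^{aa}(x)|}$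 and $e$ a constant, the deformed covariant derivative is $D_a^{(q)}=\partial_a+ie\,h_aA_a$ (no sum over $a$), and the matrix-valued field strength is $F_{ab}^{(q)}=[D_a^{(q)},D_b^{(q)}]$. In the action, repeated indices $a,b,c,d$ are summed, and $\operatorname{tr}$ is the matrix trace. All fields and $U$ are smooth.
   Formalization: The stated rule for A_a does not in general imply the stated rule for F_ab; invariance is proved for the action under F → UFU⁻¹, and for the action recomputed from the transformed A_a only when its field strength equals UFU⁻¹. *)

theory Defs
  imports "HOL-Analysis.Analysis" "HOL-Algebra.Group"
begin

section \<open>Calculus along a set of coordinates\<close>

definition partial :: "'i \<Rightarrow> (real ^ 'i \<Rightarrow> 'b::real_normed_vector) \<Rightarrow> real ^ 'i \<Rightarrow> 'b" where
  "partial a f x = vector_derivative (\<lambda>t. f (x + t *\<^sub>R axis a 1)) (at 0)"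

text \<open>\<open>smooth_along I S f\<close>: all iterated partial derivatives of \<open>f\<close> in the coordinates of \<open>I\<close>
  exist and are continuous on \<open>S\<close>.  This is the notion of a \<open>C\<^sup>\<infinity>\<close> function if \<open>S\<close> is the
  intersection of an open set with an affine subspace parallel to the coordinates of \<open>I\<close>;
  only the values of \<open>f\<close> on \<open>S\<close> matter in that case.\<close>

definition smooth_along ::
    "'i set \<Rightarrow> (real ^ 'i) set \<Rightarrow> (real ^ 'i \<Rightarrow> 'b::real_normed_vector) \<Rightarrow> bool" where
  "smooth_along I S f \<longleftrightarrow>
     (\<forall>js. set js \<subseteq> I \<longrightarrow>
        continuous_on S (foldr partial js f) \<and>
        (\<forall>a\<in>I. \<forall>x\<in>S. (\<lambda>t. foldr partial js f (x + t *\<^sub>R axis a 1)) differentiable (at 0)))"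


section \<open>The degenerate diagonal tensor and its effective sector\<close>

text \<open>Spacetime is a coordinate domain \<open>M\<close> in \<open>\<real>\<^sup>4\<close>, and \<open>g x $ \<mu> $ \<nu>\<close> is the contravariant component
  \<open>g\<^sup>\<mu>\<^sup>\<nu>(x)\<close>.  Each diagonal component either vanishes throughout \<open>M\<close> or has no zero in \<open>M\<close>, so
  that the set of coordinates of the effective sector does not depend on the point.\<close>

definition degenerate_diagonal_tensor :: "(real ^ 4) set \<Rightarrow> (real ^ 4 \<Rightarrow> real ^ 4 ^ 4) \<Rightarrow> bool" where
  "degenerate_diagonal_tensor M g \<longleftrightarrow>
     smooth_along UNIV M g \<and>
     (\<forall>x\<in>M. \<forall>\<mu> \<nu>. \<mu> \<noteq> \<nu> \<longrightarrow> g x $ \<mu> $ \<nu> = 0) \<and>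
     (\<forall>\<mu>. (\<forall>x\<in>M. g x $ \<mu> $ \<mu> = 0) \<or> (\<forall>x\<in>M. g x $ \<mu> $ \<mu> \<noteq> 0))"

text \<open>The effective indices keep their spacetime labels instead of being renumbered
  \<open>0, \<dots>, d\<^sub>e\<^sub>f\<^sub>f - 1\<close>; thus \<open>d\<^sub>e\<^sub>f\<^sub>f\<close> is the cardinality of this set.\<close>

definition eff_indices :: "(real ^ 4) set \<Rightarrow> (real ^ 4 \<Rightarrow> real ^ 4 ^ 4) \<Rightarrow> 4 set" where
  "eff_indices M g = {\<mu>. \<exists>x\<in>M. g x $ \<mu> $ \<mu> \<noteq> 0}"

text \<open>The remaining coordinates are frozen at their values at the base point \<open>p\<close>.\<close>

definition eff_sector :: "(real ^ 4) set \<Rightarrow> (real ^ 4 \<Rightarrow> real ^ 4 ^ 4) \<Rightarrow> real ^ 4 \<Rightarrow> (real ^ 4) set" where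
  "eff_sector M g p = {x \<in> M. \<forall>\<mu>. \<mu> \<notin> eff_indices M g \<longrightarrow> x $ \<mu> = p $ \<mu>}"

text \<open>The measure \<open>d\<^sup>dx\<close>, \<open>d = card I\<close>, on the affine subspace through \<open>p\<close> parallel to the
  coordinates of \<open>I\<close>.\<close>

definition slice_measure :: "4 set \<Rightarrow> real ^ 4 \<Rightarrow> (real ^ 4) measure" where
  "slice_measure I p =
     distr (Pi\<^sub>M I (\<lambda>_. lborel)) borel (\<lambda>y. \<chi> \<mu>. if \<mu> \<in> I then y \<mu> else p $ \<mu>)"

text \<open>Leibniz formula for the determinant of a matrix with rows and columns indexed by \<open>I\<close>.\<close>

definition det_on :: "'i set \<Rightarrow> ('i \<Rightarrow> 'i \<Rightarrow> real) \<Rightarrow> real" where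
  "det_on I B = (\<Sum>\<pi> | \<pi> permutes I. of_int (sign \<pi>) * (\<Prod>a\<in>I. B a (\<pi> a)))"

text \<open>Covariant components of the effective metric: the inverse of the diagonal matrix
  \<open>(g\<^sup>a\<^sup>b)\<close> with \<open>a\<close>, \<open>b\<close> effective.\<close>

definition cov_metric :: "(real ^ 4 \<Rightarrow> real ^ 4 ^ 4) \<Rightarrow> real ^ 4 \<Rightarrow> 4 \<Rightarrow> 4 \<Rightarrow> real" where
  "cov_metric g x a b = (if a = b then 1 / (g x $ a $ a) else 0)"

definition vol_density :: "(real ^ 4) set \<Rightarrow> (real ^ 4 \<Rightarrow> real ^ 4 ^ 4) \<Rightarrow> real ^ 4 \<Rightarrow> real" where
  "vol_density M g x = sqrt \<bar>det_on (eff_indices M g) (cov_metric g x)\<bar>"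


section \<open>The gauge group and its representation\<close>

text \<open>Every compact Lie group is isomorphic to a compact group of invertible complex matrices and
  vice versa, with the smooth structure and the Lie algebra induced by the matrix space.  The
  representation \<open>\<rho>\<close> in which the fields live need not be this defining one.\<close>

definition mat_monoid :: "(complex ^ 'm ^ 'm) set \<Rightarrow> (complex ^ 'm ^ 'm) monoid" where
  "mat_monoid S = \<lparr>carrier = S, mult = (**), one = mat 1\<rparr>"

definition compact_matrix_group :: "(complex ^ 'm ^ 'm) set \<Rightarrow> bool" where
  "compact_matrix_group G \<longleftrightarrow> compact G \<and> group (mat_monoid G)"

definition group_representation ::
    "(complex ^ 'm ^ 'm) set \<Rightarrow> (complex ^ 'm ^ 'm \<Rightarrow> complex ^ 'n ^ 'n) \<Rightarrow> bool" where
  "group_representation G \<rho> \<longleftrightarrow>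
     continuous_on G \<rho> \<and> \<rho> \<in> hom (mat_monoid G) (mat_monoid {B. invertible B})"

text \<open>The Lie algebra of \<open>G\<close> consists of the velocities \<open>X\<close> of the one-parameter subgroups
  \<open>t \<mapsto> exp (t X)\<close> of \<open>G\<close>, and \<open>d\<rho> X\<close> is the velocity of the image of that subgroup under \<open>\<rho>\<close>.\<close>

definition one_parameter_subgroup ::
    "(complex ^ 'm ^ 'm) set \<Rightarrow> (real \<Rightarrow> complex ^ 'm ^ 'm) \<Rightarrow> complex ^ 'm ^ 'm \<Rightarrow> bool" where
  "one_parameter_subgroup G \<gamma> X \<longleftrightarrow>
     (\<forall>t. \<gamma> t \<in> G) \<and> (\<forall>s t. \<gamma> (s + t) = \<gamma> s ** \<gamma> t) \<and> (\<gamma> has_vector_derivative X) (at 0)"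

definition represented_lie_algebra ::
    "(complex ^ 'm ^ 'm) set \<Rightarrow> (complex ^ 'm ^ 'm \<Rightarrow> complex ^ 'n ^ 'n) \<Rightarrow> (complex ^ 'n ^ 'n) set" where
  "represented_lie_algebra G \<rho> =
     {Y. \<exists>\<gamma> X. one_parameter_subgroup G \<gamma> X \<and> ((\<lambda>t. \<rho> (\<gamma> t)) has_vector_derivative Y) (at 0)}"


section \<open>Deformed covariant derivative, field strength and action\<close>

type_synonym 'n matrix_field = "real ^ 4 \<Rightarrow> complex ^ 'n ^ 'n"

definition h_factor :: "(real ^ 4 \<Rightarrow> real ^ 4 ^ 4) \<Rightarrow> 4 \<Rightarrow> real ^ 4 \<Rightarrow> real" where
  "h_factor g a x = 1 / sqrt \<bar>g x $ a $ a\<bar>"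

definition cov_deriv ::
    "(real ^ 4 \<Rightarrow> real ^ 4 ^ 4) \<Rightarrow> complex \<Rightarrow> (4 \<Rightarrow> 'n::finite matrix_field) \<Rightarrow> 4 \<Rightarrow> 'n::finite matrix_field \<Rightarrow> 'n::finite matrix_field" where
  "cov_deriv g e A a \<Psi> x =
     partial a \<Psi> x + mat (\<i> * e * of_real (h_factor g a x)) ** A a x ** \<Psi> x"

text \<open>The commutator \<open>[D\<^sub>a, D\<^sub>b]\<close> acts on smooth fields as multiplication by a matrix-valued function,
  which is its value on the constant field \<open>mat 1\<close>.\<close>

definition field_strength ::
    "(real ^ 4 \<Rightarrow> real ^ 4 ^ 4) \<Rightarrow> complex \<Rightarrow> (4 \<Rightarrow> 'n::finite matrix_field) \<Rightarrow> 4 \<Rightarrow> 4 \<Rightarrow> 'n::finite matrix_field" where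
  "field_strength g e A a b x =
     cov_deriv g e A a (cov_deriv g e A b (\<lambda>_. mat 1)) x -
     cov_deriv g e A b (cov_deriv g e A a (\<lambda>_. mat 1)) x"

lemma field_strength_explicit:
  fixes g :: "real ^ 4 \<Rightarrow> real ^ 4 ^ 4" and e :: complex and A :: "4 \<Rightarrow> 'n::finite matrix_field"
  defines "C \<equiv> \<lambda>a x. mat (\<i> * e * of_real (h_factor g a x)) ** A a x"
  shows "field_strength g e A a b x =
           partial a (C b) x - partial b (C a) x + (C a x ** C b x - C b x ** C a x)"
proof -
  have "cov_deriv g e A c (\<lambda>_. mat 1) = C c" for c
    by (rule ext) (simp add: cov_deriv_def C_def partial_def)
  then show ?thesis
    by (simp add: field_strength_def) (simp add: cov_deriv_def C_def)
qed

definition raised_field_strength ::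
    "(real ^ 4) set \<Rightarrow> (real ^ 4 \<Rightarrow> real ^ 4 ^ 4) \<Rightarrow> (4 \<Rightarrow> 4 \<Rightarrow> 'n::finite matrix_field) \<Rightarrow> 4 \<Rightarrow> 4 \<Rightarrow> 'n::finite matrix_field" where
  "raised_field_strength M g F a b x =
     (\<Sum>c\<in>eff_indices M g. \<Sum>d\<in>eff_indices M g. (g x $ a $ c * g x $ b $ d) *\<^sub>R F c d x)"

definition YM_integrand ::
    "(real ^ 4) set \<Rightarrow> (real ^ 4 \<Rightarrow> real ^ 4 ^ 4) \<Rightarrow> (4 \<Rightarrow> 4 \<Rightarrow> 'n::finite matrix_field) \<Rightarrow> real ^ 4 \<Rightarrow> complex" where
  "YM_integrand M g F x =
     of_real (vol_density M g x) *
     (\<Sum>a\<in>eff_indices M g. \<Sum>b\<in>eff_indices M g. trace (F a b x ** raised_field_strength M g F a b x))"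

text \<open>The integral is Lebesgue's; its value is only meaningful if \<open>YM_integrable\<close> holds.\<close>

definition YM_integrable ::
    "(real ^ 4) set \<Rightarrow> (real ^ 4 \<Rightarrow> real ^ 4 ^ 4) \<Rightarrow> real ^ 4 \<Rightarrow> (4 \<Rightarrow> 4 \<Rightarrow> 'n::finite matrix_field) \<Rightarrow> bool" where
  "YM_integrable M g p F \<longleftrightarrow>
     set_integrable (slice_measure (eff_indices M g) p) (eff_sector M g p) (YM_integrand M g F)"

definition YM_action ::
    "(real ^ 4) set \<Rightarrow> (real ^ 4 \<Rightarrow> real ^ 4 ^ 4) \<Rightarrow> real ^ 4 \<Rightarrow> (4 \<Rightarrow> 4 \<Rightarrow> 'n::finite matrix_field) \<Rightarrow> complex" where
  "YM_action M g p F =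
     - (1 / 4) * (LINT x : eff_sector M g p | slice_measure (eff_indices M g) p. YM_integrand M g F x)"


section \<open>Gauge transformations\<close>

text \<open>\<open>V\<close> is the local gauge transformation \<open>U\<close> in the given representation, \<open>V x = \<rho> (U x)\<close>.
  A gauge transformation is given by both rules together: with the deformed derivative
  \<open>\<partial>\<^sub>a + \<i> e h\<^sub>a A\<^sub>a\<close>, the field strength of \<open>gauge_potential V A\<close> need not coincide with
  \<open>gauge_field_strength V (field_strength g e A)\<close>.\<close>

definition gauge_potential ::
    "'n::finite matrix_field \<Rightarrow> (4 \<Rightarrow> 'n::finite matrix_field) \<Rightarrow> 4 \<Rightarrow> 'n::finite matrix_field" where
  "gauge_potential V A a x =
     V x ** A a x ** matrix_inv (V x) + V x ** partial a (\<lambda>y. matrix_inv (V y)) x"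

definition gauge_field_strength ::
    "'n::finite matrix_field \<Rightarrow> (4 \<Rightarrow> 4 \<Rightarrow> 'n::finite matrix_field) \<Rightarrow> 4 \<Rightarrow> 4 \<Rightarrow> 'n::finite matrix_field" where
  "gauge_field_strength V F a b x = V x ** F a b x ** matrix_inv (V x)"

end

theory Submission
  imports Defs
begin

text \<open>The invariance is pointwise. At a point \<open>x\<close> of the sector,
  \<open>V x\<close> is invertible, being the image of a group element under a representation. The
  map C \<mapsto> \<open>V x ** C ** matrix_inv (V x)\<close> is real-linear and multiplicative and
  preserves the trace. The metric is a fixed background, so indices are raised by a real linear
  combination, which commutes with this map (\<open>raised_gauge_field_strength\<close>). Each
  product of the field strength with its raised version is therefore conjugated as a whole, and its
  trace is unchanged (\<open>YM_integrand_gauge\<close>). Equal integrands on the sector give equal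
  actions and the same integrability (\<open>YM_integrable_action_cong\<close>).\<close>

lemma matrix_inv_mul:
  fixes B :: "'a::semiring_1 ^ 'n ^ 'm"
  assumes "invertible B"
  shows "B ** matrix_inv B = mat 1" "matrix_inv B ** B = mat 1"
  \<comment> \<open>\<open>matrix_inv\<close> is a Hilbert choice of a two-sided inverse, and
    invertibility says that one exists.\<close>
  using someI_ex[OF assms[unfolded invertible_def]] by (simp_all add: matrix_inv_def)

text \<open>Cyclicity of the trace brings the inverse next to \<open>B\<close>, where the two
  cancel.\<close>

lemma trace_conjugate:
  fixes B C :: "'a::comm_semiring_1 ^ 'n ^ 'n"
  assumes "invertible B"
  shows "trace (B ** C ** matrix_inv B) = trace C"
proof -
  have "trace (B ** C ** matrix_inv B) = trace (matrix_inv B ** (B ** C))"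
    by (rule trace_mul_sym)
  also have "matrix_inv B ** (B ** C) = C"
    by (simp add: matrix_mul_assoc matrix_inv_mul[OF assms])
  finally show ?thesis .
qed

lemma conjugate_matrix_mul:
  fixes B C D :: "'a::semiring_1 ^ 'n ^ 'n"
  assumes "invertible B"
  shows "(B ** C ** matrix_inv B) ** (B ** D ** matrix_inv B) = B ** (C ** D) ** matrix_inv B"
proof -
  have "(B ** C ** matrix_inv B) ** (B ** D ** matrix_inv B) =
      B ** C ** (matrix_inv B ** B) ** D ** matrix_inv B"
    by (simp add: matrix_mul_assoc)
  then show ?thesis
    by (simp add: matrix_inv_mul[OF assms] matrix_mul_assoc)
qed

text \<open>Linearity over the reals suffices, because the coefficients that raise indices are real
  scalars.\<close>

lemma linear_conjugate:
  fixes B D :: "'a::real_normed_algebra_1 ^ 'n ^ 'n"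
  shows "linear (\<lambda>C. B ** C ** D)"
  by (rule linearI)
     (simp_all add: matrix_matrix_mult_def vec_eq_iff algebra_simps sum.distrib flip: scaleR_sum_right)

lemma raised_gauge_field_strength:
  "raised_field_strength M g (gauge_field_strength V F) a b x =
     gauge_field_strength V (raised_field_strength M g F) a b x"
proof -
  note lin = linear_conjugate[of "V x" "matrix_inv (V x)"]
  show ?thesis
    by (simp add: raised_field_strength_def gauge_field_strength_def
        linear_sum[OF lin] linear_scale[OF lin])
qed

lemma YM_integrand_gauge:
  assumes "invertible (V x)"
  shows "YM_integrand M g (gauge_field_strength V F) x = YM_integrand M g F x"
  unfolding YM_integrand_def raised_gauge_field_strength
  by (simp add: gauge_field_strength_def conjugate_matrix_mul[OF assms] trace_conjugate[OF assms])

text \<open>All index sums, including those that raise indices, run over the effective indices. This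
  matches the last part of the theorem, where the two field strengths are compared on these indices
  only.\<close>

lemma YM_integrand_cong:
  assumes "\<And>a b. \<lbrakk>a \<in> eff_indices M g; b \<in> eff_indices M g\<rbrakk> \<Longrightarrow> F a b x = F' a b x"
  shows "YM_integrand M g F x = YM_integrand M g F' x"
  using assms by (simp add: YM_integrand_def raised_field_strength_def)

text \<open>Integrability and integral over a set are defined through the integrand times the
  indicator of the set, so the values off the sector do not matter. The two functions under the
  integral are identical, so the actions agree even when the integral does not exist.\<close>

lemma YM_integrable_action_cong:
  assumes "\<And>x. x \<in> eff_sector M g p \<Longrightarrow> YM_integrand M g F x = YM_integrand M g F' x"
  shows "YM_integrable M g p F \<longleftrightarrow> YM_integrable M g p F'"
    and "YM_action M g p F = YM_action M g p F'"
proof -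
  have "(\<lambda>x. indicator (eff_sector M g p) x *\<^sub>R YM_integrand M g F x) =
      (\<lambda>x. indicator (eff_sector M g p) x *\<^sub>R YM_integrand M g F' x)"
    using assms by (auto simp: fun_eq_iff indicator_def)
  then show "YM_integrable M g p F \<longleftrightarrow> YM_integrable M g p F'"
    and "YM_action M g p F = YM_action M g p F'"
    by (simp_all add: YM_integrable_def YM_action_def set_integrable_def
        set_lebesgue_integral_def)
qed

lemma group_representation_invertible:
  assumes "group_representation G \<rho>" "B \<in> G"
  shows "invertible (\<rho> B)"
  using assms by (auto simp: group_representation_def hom_def mat_monoid_def)

theorem proposition5p5:
  fixes M :: "(real ^ 4) set" and g :: "real ^ 4 \<Rightarrow> real ^ 4 ^ 4" and p :: "real ^ 4"
    and G :: "(complex ^ 'm ^ 'm) set" and \<rho> :: "complex ^ 'm ^ 'm \<Rightarrow> complex ^ 'n ^ 'n"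
    and e :: complex
    and A :: "4 \<Rightarrow> real ^ 4 \<Rightarrow> complex ^ 'n ^ 'n" and U :: "real ^ 4 \<Rightarrow> complex ^ 'm ^ 'm"
  assumes spacetime: "open M" "p \<in> M"
    and metric: "degenerate_diagonal_tensor M g"
    and group: "compact_matrix_group G" "group_representation G \<rho>"
    and gauge_field:
      "\<And>a. a \<in> eff_indices M g \<Longrightarrow> smooth_along (eff_indices M g) (eff_sector M g p) (A a)"
      "\<And>a x. a \<in> eff_indices M g \<Longrightarrow> x \<in> eff_sector M g p \<Longrightarrow> A a x \<in> represented_lie_algebra G \<rho>"
    and gauge_transformation:
      "smooth_along (eff_indices M g) (eff_sector M g p) U"
      "\<And>x. x \<in> eff_sector M g p \<Longrightarrow> U x \<in> G"
  defines "V \<equiv> \<lambda>x. \<rho> (U x)"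
  defines "F \<equiv> field_strength g e A"
  defines "F' \<equiv> gauge_field_strength V F"
  defines "A' \<equiv> gauge_potential V A"
  shows "(YM_integrable M g p F' \<longleftrightarrow> YM_integrable M g p F) \<and>
         YM_action M g p F' = YM_action M g p F \<and>
         ((\<forall>a\<in>eff_indices M g. \<forall>b\<in>eff_indices M g. \<forall>x\<in>eff_sector M g p.
             field_strength g e A' a b x = F' a b x) \<longrightarrow>
            (YM_integrable M g p (field_strength g e A') \<longleftrightarrow> YM_integrable M g p F) \<and>
            YM_action M g p (field_strength g e A') = YM_action M g p F)"
proof -
  have inv: "invertible (V x)" if "x \<in> eff_sector M g p" for x
    unfolding V_def
    using group(2) gauge_transformation(2)[OF that] by (rule group_representation_invertible)
  have integrand: "YM_integrand M g F' x = YM_integrand M g F x" if "x \<in> eff_sector M g p" for x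
    unfolding F'_def using inv[OF that] by (rule YM_integrand_gauge)
  \<comment> \<open>Under the compatibility premise the field strength of \<open>A'\<close> can be
    replaced by \<open>F'\<close> inside the integrand, which reduces this case to the previous
    one.\<close>
  have "YM_integrand M g (field_strength g e A') x = YM_integrand M g F x"
    if "\<forall>a\<in>eff_indices M g. \<forall>b\<in>eff_indices M g. \<forall>x\<in>eff_sector M g p.
      field_strength g e A' a b x = F' a b x" "x \<in> eff_sector M g p" for x
    using YM_integrand_cong[of M g "field_strength g e A'" x F'] integrand that by simp
  then show ?thesis
    using YM_integrable_action_cong[of M g p F' F, OF integrand]
      YM_integrable_action_cong[of M g p "field_strength g e A'" F] by blast
qed

end
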